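(* Let $K$ be a field with a fixed algebraic closure $\overline{K}$, let $X$ be an indeterminate, and let $v$ be a valuation on $\overline{K}(X)$ such that the extension $(K(X)|K,v)$ is valuation transcendental. Let $(a,\gamma)$ and $(a',\gamma)$ be minimal pairs of definition for $v$ over $K$. Then $$j(a)=j(a').$$
   Context: Valuations are Krull valuations (of arbitrary rank), written additively, with $v0=\infty$. For a valued field $(F,v)$, $vF$ denotes the value group and $Fv$ the residue field; restrictions of $v$ to subfields are again denoted by $v$. The extension $(K(X)|K,v)$ is called valuation transcendental if $\dim_{\mathbb{Q}}\big(\mathbb{Q}\otimes_{\mathbb{Z}}(vK(X)/vK)\big)+\mathrm{trdeg}[K(X)v:Kv]=1$ (in general the left side is at most $1$). A pair $(a,\gamma)\in\overline{K}\times v\overline{K}(X)$ is a minimal pair of definition for $v$ over $K$ if (MP1) $v(X-a)=\gamma=\max\{v(X-c)\mid c\in\overline{K}\}$, and (MP2) for all $b\in\overline{K}$, $v(a-b)\geq\gamma$ implies $[K(b):K]\geq[K(a):K]$. For a minimal pair of definition $(a,\gamma)$ for $v$ over $K$, $j(a)=j(a,K,\gamma)$ denotes the number of conjugates $a_i$ of $a$ over $K$ with $v(a-a_i)\geq\gamma$, including $a$ itself and counting multiplicities (that is, the number, with multiplicity, of roots $a_i\in\overline{K}$ of the minimal polynomial of $a$ over $K$ satisfying $v(a-a_i)\geq\gamma$). *)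

theory Defs
  imports
    "HOL-Library.Extended"
    "HOL-Library.Extended_Nat"
    "HOL-Computational_Algebra.Computational_Algebra"
    "HOL-Algebra.Algebra"
    "HOL-Algebra.Algebraic_Closure_Type"
begin

text \<open>
  The field \<open>K\<close> is a subset of a type \<open>'l\<close> which is an algebraic closure of it. The rational
  function field in one indeterminate over \<open>'l\<close> is the type \<open>'l poly fract\<close>; its constants are the
  \<open>const_rf c\<close> and its indeterminate is \<open>X_rf\<close>. A type class field becomes a record of HOL-Algebra
  through \<open>ring_of_type_algebra\<close>.
\<close>

abbreviation const_rf :: "'l::field \<Rightarrow> 'l poly fract" where
  "const_rf c \<equiv> to_fract [:c:]"

abbreviation X_rf :: "'l::field poly fract" where
  "X_rf \<equiv> to_fract [:0, 1:]"

definition rational_functions :: "'l::field set \<Rightarrow> 'l poly fract set" where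
  "rational_functions K = generate_field ring_of_type_algebra (insert X_rf (const_rf ` K))"

definition ext_degree :: "'l::field set \<Rightarrow> 'l \<Rightarrow> nat" where
  "ext_degree K b =
     ring.dim ring_of_type_algebra K (generate_field ring_of_type_algebra (insert b K))"


section \<open>Krull valuations\<close>

text \<open>The value \<open>\<infinity>\<close> is \<open>Pinf\<close>; the element \<open>Minf\<close> of the type \<open>'g extended\<close> is never a value.
  Since \<open>'g\<close> need not be the value group, there is no surjectivity requirement.\<close>

definition krull_valuation :: "('f::field \<Rightarrow> 'g::linordered_ab_group_add extended) \<Rightarrow> bool" where
  "krull_valuation v \<longleftrightarrow>
     (\<forall>x. v x \<noteq> Minf) \<and>
     (\<forall>x. v x = Pinf \<longleftrightarrow> x = 0) \<and>
     (\<forall>x y. v (x * y) = v x + v y) \<and>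
     (\<forall>x y. min (v x) (v y) \<le> v (x + y))"

text \<open>Value group and residue field of the restriction of \<open>v\<close> to a subfield \<open>F\<close>.\<close>

definition value_group ::
  "('f::field \<Rightarrow> 'g::linordered_ab_group_add extended) \<Rightarrow> 'f set \<Rightarrow> 'g monoid" where
  "value_group v F = \<lparr>carrier = {g. \<exists>x\<in>F. v x = Fin g}, monoid.mult = (+), one = 0\<rparr>"

definition valuation_ring ::
  "('f::field \<Rightarrow> 'g::linordered_ab_group_add extended) \<Rightarrow> 'f set \<Rightarrow> 'f ring" where
  "valuation_ring v F = ring_of_type_algebra\<lparr>carrier := {x \<in> F. 0 \<le> v x}\<rparr>"

definition valuation_ideal ::
  "('f::field \<Rightarrow> 'g::linordered_ab_group_add extended) \<Rightarrow> 'f set \<Rightarrow> 'f set" where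
  "valuation_ideal v F = {x \<in> F. 0 < v x}"

definition residue_field ::
  "('f::field \<Rightarrow> 'g::linordered_ab_group_add extended) \<Rightarrow> 'f set \<Rightarrow> 'f set ring" where
  "residue_field v F = valuation_ring v F Quot valuation_ideal v F"

text \<open>For subfields \<open>F \<subseteq> E\<close>, the image of the residue field of \<open>F\<close> in that of \<open>E\<close> under the
  canonical embedding.\<close>

definition residue_subfield ::
  "('f::field \<Rightarrow> 'g::linordered_ab_group_add extended) \<Rightarrow> 'f set \<Rightarrow> 'f set \<Rightarrow> 'f set set" where
  "residue_subfield v E F =
     (\<lambda>x. valuation_ideal v E +>\<^bsub>valuation_ring v E\<^esub> x) ` carrier (valuation_ring v F)"


section \<open>Dimension, tensor product with the rationals, transcendence degree\<close>

definition lin_independent :: "('k, 'r) ring_scheme \<Rightarrow> ('k, 'm, 's) module_scheme \<Rightarrow> 'm set \<Rightarrow> bool" where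
  "lin_independent R M B \<longleftrightarrow>
     (\<forall>c \<in> B \<rightarrow> carrier R. (\<Oplus>\<^bsub>M\<^esub>b\<in>B. c b \<odot>\<^bsub>M\<^esub> b) = \<zero>\<^bsub>M\<^esub> \<longrightarrow> (\<forall>b\<in>B. c b = \<zero>\<^bsub>R\<^esub>))"

definition vs_dim :: "('k, 'r) ring_scheme \<Rightarrow> ('k, 'm, 's) module_scheme \<Rightarrow> enat" where
  "vs_dim R M = (SUP B \<in> {B. finite B \<and> B \<subseteq> carrier M \<and> lin_independent R M B}. enat (card B))"

text \<open>The tensor product of the rationals with an abelian group \<open>A\<close> (written multiplicatively, as
  all groups in HOL-Algebra): the free abelian group on the pairs \<open>(q, x)\<close>, modulo the biadditivity
  relations. The scalar \<open>q\<close> maps the class of \<open>(r, x)\<close> to the class of \<open>(q * r, x)\<close>. The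
  multiplicative fields of the module record have no meaning here.\<close>

definition rat_tensor_relations :: "('a, 'm) monoid_scheme \<Rightarrow> (rat \<times> 'a \<Rightarrow>\<^sub>0 int) set" where
  "rat_tensor_relations A =
     {frag_of (q + r, x) - frag_of (q, x) - frag_of (r, x) | q r x. x \<in> carrier A} \<union>
     {frag_of (q, x \<otimes>\<^bsub>A\<^esub> y) - frag_of (q, x) - frag_of (q, y) | q x y. x \<in> carrier A \<and> y \<in> carrier A}"

definition rat_tensor :: "('a, 'm) monoid_scheme \<Rightarrow> (rat, (rat \<times> 'a \<Rightarrow>\<^sub>0 int) set) module" where
  "rat_tensor A =
     (let F = free_Abelian_group (UNIV \<times> carrier A);
          N = generate F (rat_tensor_relations A);
          T = F Mod N
      in \<lparr>carrier = carrier T, monoid.mult = undefined, one = undefined,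
          ring.zero = \<one>\<^bsub>T\<^esub>, add = (\<otimes>\<^bsub>T\<^esub>),
          module.smult = (\<lambda>q C. \<Union>z\<in>C. N #>\<^bsub>F\<^esub> frag_extend (\<lambda>(r, x). frag_of (q * r, x)) z)\<rparr>)"

text \<open>A finite set \<open>B\<close> is algebraically independent over \<open>F\<close> if distinct monomials in its elements
  are linearly independent over \<open>F\<close>, a monomial being given by its exponent function \<open>e\<close>.\<close>

definition alg_independent :: "('a, 'm) ring_scheme \<Rightarrow> 'a set \<Rightarrow> 'a set \<Rightarrow> bool" where
  "alg_independent R F B \<longleftrightarrow>
     (\<forall>M c. finite M \<and> M \<subseteq> (B \<rightarrow>\<^sub>E (UNIV :: nat set)) \<and> c \<in> M \<rightarrow> F \<and>
        (\<Oplus>\<^bsub>R\<^esub>e\<in>M. c e \<otimes>\<^bsub>R\<^esub> (\<Otimes>\<^bsub>R\<^esub>b\<in>B. b [^]\<^bsub>R\<^esub> e b)) = \<zero>\<^bsub>R\<^esub>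
      \<longrightarrow> (\<forall>e\<in>M. c e = \<zero>\<^bsub>R\<^esub>))"

definition trdeg :: "('a, 'm) ring_scheme \<Rightarrow> 'a set \<Rightarrow> enat" where
  "trdeg R F = (SUP B \<in> {B. finite B \<and> B \<subseteq> carrier R \<and> alg_independent R F B}. enat (card B))"

definition valuation_transcendental ::
  "('f::field \<Rightarrow> 'g::linordered_ab_group_add extended) \<Rightarrow> 'f set \<Rightarrow> 'f set \<Rightarrow> bool" where
  "valuation_transcendental v E F \<longleftrightarrow>
     vs_dim (ring_of_type_algebra :: rat ring)
       (rat_tensor (value_group v E Mod carrier (value_group v F)))
     + trdeg (residue_field v E) (residue_subfield v E F) = 1"


section \<open>Minimal pairs of definition\<close>

definition minimal_pair ::
  "('l::field poly fract \<Rightarrow> 'g::linordered_ab_group_add extended) \<Rightarrow> 'l set \<Rightarrow> 'l \<Rightarrow> 'g \<Rightarrow> bool" where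
  "minimal_pair v K a \<gamma> \<longleftrightarrow>
     \<gamma> \<in> carrier (value_group v UNIV) \<and>
     v (X_rf - const_rf a) = Fin \<gamma> \<and>
     (\<forall>c. v (X_rf - const_rf c) \<le> Fin \<gamma>) \<and>
     (\<forall>b. Fin \<gamma> \<le> v (const_rf (a - b)) \<longrightarrow> ext_degree K a \<le> ext_degree K b)"

definition j_invariant ::
  "('l::field poly fract \<Rightarrow> 'g::linordered_ab_group_add extended) \<Rightarrow> 'l set \<Rightarrow> 'g \<Rightarrow> 'l \<Rightarrow> nat" where
  "j_invariant v K \<gamma> a =
     size {# c \<in># ring.roots ring_of_type_algebra (ring.Irr ring_of_type_algebra K a).
             Fin \<gamma> \<le> v (const_rf (a - c)) #}"

end

theory Submission
  imports Defs
begin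

text \<open>
  Every root count below takes place in the ball of radius \<open>\<gamma>\<close> around \<open>a\<close>. It contains \<open>a'\<close>,
  because \<open>X - a\<close> and \<open>X - a'\<close> both have value \<open>\<gamma>\<close>; hence \<open>a\<close> and \<open>a'\<close> have the same degree \<open>n\<close>
  over \<open>K\<close>, and by minimality no element of the ball has a smaller degree.

  Let \<open>P\<close> and \<open>P'\<close> be the minimal polynomials of \<open>a\<close> and \<open>a'\<close>, and translate \<open>a\<close> to the origin. For
  a polynomial with a given splitting, the number of roots in the ball can be read off its
  coefficients: it is the largest index \<open>i\<close> at which the value of the \<open>i\<close>-th coefficient plus
  \<open>i\<gamma>\<close> attains its minimum over all \<open>i\<close> (\<open>dominant_index_of_split\<close>). So it suffices
  that the perturbation \<open>P' - P\<close> does not affect this index. Both polynomials are monic of degree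
  \<open>n\<close>, so a nonzero \<open>P' - P\<close> has degree less than \<open>n\<close>, and all its roots lie outside the ball.
  Therefore its minimum \<open>k\<close> is attained at the index 0 alone, and \<open>k\<close> is also the value of
  \<open>P' - P\<close> at every point of the ball.
  At the point \<open>a'\<close> the values of \<open>P' - P\<close> and \<open>P\<close> agree, because \<open>P'\<close> vanishes there, and the value
  of \<open>P\<close> is at least its minimum \<open>m\<close>. Thus \<open>k\<close> is at least \<open>m\<close>, and at all positive indices the
  perturbation lies strictly above \<open>m\<close>. Finally the dominant index of \<open>P\<close> is
  positive, since \<open>P\<close> vanishes at \<open>a\<close>; so it is also that of \<open>P'\<close>
  (\<open>count_roots_in_ball_eq\<close>).

  The minimal polynomials and their root multisets are given in terms of coefficient lists; the
  lemmas on these turn them into polynomials with an explicit splitting.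
\<close>


section \<open>Valuations and roots in a ball\<close>

lemma ext_add_le_less:
  fixes x y x' y' :: "'g::linordered_ab_group_add extended"
  assumes "x \<le> y" "x' < y'" "x \<noteq> Minf" "x \<noteq> Pinf"
  shows "x + x' < y + y'"
  using assms by (cases x; cases y; cases x'; cases y') (auto intro: add_le_less_mono)

context
  fixes w :: "'f::field \<Rightarrow> 'g::linordered_ab_group_add extended"
  assumes w: "krull_valuation w"
begin

lemma val_not_Minf: "w x \<noteq> Minf"
  and val_Pinf_iff: "w x = Pinf \<longleftrightarrow> x = 0"
  and val_mult: "w (x * y) = w x + w y"
  and val_add: "min (w x) (w y) \<le> w (x + y)"
  using w by (auto simp: krull_valuation_def)

lemma val_zero: "w 0 = Pinf" by (simp add: val_Pinf_iff)

lemma val_one: "w 1 = 0"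
  using val_mult[of 1 1] val_not_Minf[of 1] val_Pinf_iff[of 1] by (cases "w 1") (auto simp: zero_extended_def)

lemma val_uminus: "w (- x) = w x"
proof -
  have "w (-1) = 0"
    using val_mult[of "-1" "-1"] val_one val_not_Minf[of "-1"] val_Pinf_iff[of "-1"]
    by (cases "w (-1)") (auto simp: zero_extended_def double_zero_sym)
  thus ?thesis using val_mult[of "-1" x] by simp
qed

lemma val_diff: "min (w x) (w y) \<le> w (x - y)"
  using val_add[of x "-y"] by (simp add: val_uminus)

lemma val_minus_commute: "w (x - y) = w (y - x)"
  using val_uminus[of "x - y"] by simp

lemma val_add_eq: assumes "w x < w y" shows "w (x + y) = w x"
proof -
  have "w x \<le> w (x + y)" using val_add[of x y] assms by (simp add: min_def less_imp_le)
  moreover have "min (w (x + y)) (w y) \<le> w x" using val_diff[of "x + y" y] by simp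
  ultimately show ?thesis using assms by (auto simp: min_def split: if_splits)
qed

text \<open>The sum stands for the multiple \<open>i\<gamma>\<close> in the value group.\<close>

definition gauss_term :: "'g \<Rightarrow> 'f poly \<Rightarrow> nat \<Rightarrow> 'g extended" where
  "gauss_term \<gamma> p i = w (coeff p i) + (\<Sum>k<i. Fin \<gamma>)"

text \<open>In terms of Newton polygons, \<open>j\<close> is the right end of the face of slope \<open>- \<gamma>\<close>; \<open>m\<close> is the value of
  \<open>p\<close> under the Gauss extension of \<open>w\<close> that gives the indeterminate the value \<open>\<gamma>\<close>.\<close>

definition dominant_index :: "'g \<Rightarrow> 'f poly \<Rightarrow> nat \<Rightarrow> 'g \<Rightarrow> bool" where
  "dominant_index \<gamma> p j m \<longleftrightarrow>
     (\<forall>i. Fin m \<le> gauss_term \<gamma> p i) \<and> gauss_term \<gamma> p j = Fin m \<and> (\<forall>i>j. Fin m < gauss_term \<gamma> p i)"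

lemma sum_Fin: "\<exists>g. (\<Sum>k<i::nat. Fin (\<gamma>::'g)) = Fin g"
  by (induction i) (auto simp: zero_extended_def)

lemma gauss_term_add: "min (gauss_term \<gamma> p i) (gauss_term \<gamma> q i) \<le> gauss_term \<gamma> (p + q) i"
proof -
  obtain g where g: "(\<Sum>k<i. Fin \<gamma>) = Fin g" using sum_Fin by blast
  have "min (x + Fin g) (y + Fin g) \<le> z + Fin g" if "min x y \<le> z" for x y z
    using that by (cases x; cases y; cases z) (auto simp: min_def split: if_splits)
  from this[OF val_add[of "coeff p i" "coeff q i"]] show ?thesis
    by (simp add: gauss_term_def g)
qed

lemma gauss_term_add_eq:
  assumes "gauss_term \<gamma> p i < gauss_term \<gamma> q i"
  shows "gauss_term \<gamma> (p + q) i = gauss_term \<gamma> p i"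
proof -
  obtain g where g: "(\<Sum>k<i. Fin \<gamma>) = Fin g" using sum_Fin by blast
  have "x < y" if "x + Fin g < y + Fin g" for x y
    using that by (cases x; cases y) auto
  with assms have "w (coeff p i) < w (coeff q i)" by (auto simp: gauss_term_def g)
  thus ?thesis by (simp add: gauss_term_def val_add_eq)
qed

lemma dominant_index_unique:
  assumes "dominant_index \<gamma> p j m" "dominant_index \<gamma> p j' m'"
  shows "j = j'"
proof -
  have "j = j'" if "j \<le> j'" "dominant_index \<gamma> p j m" "dominant_index \<gamma> p j' m'" for j j' m m'
  proof (rule ccontr)
    assume "j \<noteq> j'"
    with that(1) have "j < j'" by simp
    with that(2,3) have "Fin m < Fin m'" "Fin m' \<le> Fin m" unfolding dominant_index_def by metis+
    thus False by simp
  qed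
  thus ?thesis using assms by (metis nat_le_linear)
qed

text \<open>The product is the shift of \<open>p\<close> by one place minus \<open>d\<close> times \<open>p\<close>. The shift raises the minimum
  by \<open>\<gamma>\<close> and the index by one, the multiple raises the minimum by the value of \<open>d\<close> and keeps the index.
  The summand with the smaller minimum decides; if the minima coincide, it is the shift, whose index
  is the larger one.\<close>

lemma dominant_index_linear_mult:
  assumes "dominant_index \<gamma> p j m"
  shows "\<exists>m'. Fin m' = Fin m + min (Fin \<gamma>) (w d) \<and>
     dominant_index \<gamma> ([:-d, 1:] * p) (if Fin \<gamma> \<le> w d then Suc j else j) m'"
proof -
  define q where "q = pCons 0 p"
  define s where "s = smult (-d) p"
  have prod: "[:-d, 1:] * p = s + q"
    by (simp add: s_def q_def)
  have q0: "gauss_term \<gamma> q 0 = Pinf" 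
    by (simp add: gauss_term_def q_def val_zero zero_extended_def)
  have qS: "gauss_term \<gamma> q (Suc i) = gauss_term \<gamma> p i + Fin \<gamma>" for i
    by (simp add: gauss_term_def q_def add_ac)
  have s: "gauss_term \<gamma> s i = w d + gauss_term \<gamma> p i" for i
    by (simp add: gauss_term_def s_def val_mult val_uminus add_ac)
  have p: "Fin m \<le> gauss_term \<gamma> p i" "gauss_term \<gamma> p j = Fin m" "i > j \<Longrightarrow> Fin m < gauss_term \<gamma> p i" for i
    using assms by (auto simp: dominant_index_def)
  show ?thesis
  proof (cases "Fin \<gamma> \<le> w d")
    case True
    have q_ge: "Fin (m + \<gamma>) \<le> gauss_term \<gamma> q i" for i
      using p(1)[of "i - 1"] by (cases i; cases "gauss_term \<gamma> p (i - 1)") (auto simp: q0 qS)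
    have s_ge: "Fin (m + \<gamma>) \<le> gauss_term \<gamma> s i" for i
      using add_mono[OF p(1) True, of i] by (simp add: s add_ac)
    have s_gt: "Fin (m + \<gamma>) < gauss_term \<gamma> s i" if "i > j" for i
      using ext_add_le_less[OF True p(3)[OF that]] by (simp add: s add_ac)
    have q_gt: "Fin (m + \<gamma>) < gauss_term \<gamma> q i" if "i > Suc j" for i
      using that p(3)[of "i - 1"] by (cases i; cases "gauss_term \<gamma> p (i - 1)") (auto simp: qS)
    have "dominant_index \<gamma> (s + q) (Suc j) (m + \<gamma>)"
      unfolding dominant_index_def
    proof (intro conjI allI impI)
      fix i show "Fin (m + \<gamma>) \<le> gauss_term \<gamma> (s + q) i"
        using gauss_term_add[of \<gamma> s i q] q_ge[of i] s_ge[of i] by (meson min.boundedI order_trans)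
    next
      have "gauss_term \<gamma> q (Suc j) = Fin (m + \<gamma>)" by (simp add: qS p(2))
      thus "gauss_term \<gamma> (s + q) (Suc j) = Fin (m + \<gamma>)"
        using gauss_term_add_eq[of \<gamma> q "Suc j" s] s_gt[of "Suc j"] by (simp add: add.commute)
    next
      fix i assume "i > Suc j"
      thus "Fin (m + \<gamma>) < gauss_term \<gamma> (s + q) i"
        using gauss_term_add[of \<gamma> s i q] q_gt[of i] s_gt[of i] 
        by (meson Suc_lessD less_le_trans min_less_iff_conj)
    qed
    thus ?thesis using True prod by (intro exI[of _ "m + \<gamma>"]) (simp add: min_def)
  next
    case False
    then obtain \<delta> where \<delta>: "w d = Fin \<delta>" "\<delta> < \<gamma>"
      using val_not_Minf[of d] by (cases "w d") auto
    have q_gt: "Fin (m + \<delta>) < gauss_term \<gamma> q i" for i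
      using p(1)[of "i - 1"] \<delta>(2) by (cases i; cases "gauss_term \<gamma> p (i - 1)") 
         (auto simp: q0 qS intro: add_le_less_mono)
    have s_ge: "Fin (m + \<delta>) \<le> gauss_term \<gamma> s i" for i
      using p(1)[of i] by (cases "gauss_term \<gamma> p i") (auto simp: s \<delta> add_ac)
    have s_gt: "Fin (m + \<delta>) < gauss_term \<gamma> s i" if "i > j" for i
      using p(3)[OF that] by (cases "gauss_term \<gamma> p i") (auto simp: s \<delta> add_ac)
    have "dominant_index \<gamma> (s + q) j (m + \<delta>)"
      unfolding dominant_index_def
    proof (intro conjI allI impI)
      fix i show "Fin (m + \<delta>) \<le> gauss_term \<gamma> (s + q) i"
        using gauss_term_add[of \<gamma> s i q] q_gt[of i] s_ge[of i] by (meson min.boundedI order_trans less_imp_le)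
    next
      have "gauss_term \<gamma> s j = Fin (m + \<delta>)" by (simp add: s p(2) \<delta> add_ac)
      thus "gauss_term \<gamma> (s + q) j = Fin (m + \<delta>)"
        using gauss_term_add_eq[of \<gamma> s j q] q_gt[of j] by (simp add: add.commute)
    next
      fix i assume "i > j"
      thus "Fin (m + \<delta>) < gauss_term \<gamma> (s + q) i"
        using gauss_term_add[of \<gamma> s i q] q_gt[of i] s_gt[of i] 
        by (meson less_le_trans min_less_iff_conj)
    qed
    moreover have "min (Fin \<gamma>) (w d) = Fin \<delta>" using \<delta> by simp
    ultimately show ?thesis using False prod by (intro exI[of _ "m + \<delta>"]) simp
  qed
qed

text \<open>The formula for \<open>m\<close> makes it comparable with values of the polynomial at points, which
  \<open>val_poly_split\<close> expresses by the same roots.\<close>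

lemma dominant_index_of_split:
  assumes "e \<noteq> 0"
  shows "\<exists>m. Fin m = w e + (\<Sum>d\<in>#D. min (Fin \<gamma>) (w d)) \<and>
     dominant_index \<gamma> (smult e (\<Prod>d\<in>#D. [:-d, 1:])) (size {#d \<in># D. Fin \<gamma> \<le> w d#}) m"
proof (induction D)
  case empty
  obtain m where m: "w e = Fin m" using val_not_Minf[of e] val_Pinf_iff[of e] assms by (cases "w e") auto
  have "gauss_term \<gamma> [:e:] i = (if i = 0 then Fin m else Pinf)" for i
    using sum_Fin[of \<gamma> i] by (cases i) (auto simp: gauss_term_def m val_zero)
  thus ?case using m by (auto simp: dominant_index_def)
next
  case (add d D)
  then obtain m where m: "Fin m = w e + (\<Sum>d\<in>#D. min (Fin \<gamma>) (w d))"
    "dominant_index \<gamma> (smult e (\<Prod>d\<in>#D. [:-d, 1:])) (size {#d \<in># D. Fin \<gamma> \<le> w d#}) m" by blast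
  from dominant_index_linear_mult[OF m(2), of d] show ?case
    by (force simp: m(1) add_ac mult.commute)
qed

lemma val_poly_split:
  "w (poly (smult e (\<Prod>d\<in>#D. [:-d, 1:])) x) = w e + (\<Sum>d\<in>#D. w (x - d))"
proof -
  have "poly (\<Prod>d\<in>#D. [:-d, 1:]) x = (\<Prod>d\<in>#D. x - d)"
    by (induction D) (simp_all add: algebra_simps)
  moreover have "w (\<Prod>d\<in>#D. x - d) = (\<Sum>d\<in>#D. w (x - d))"
    by (induction D) (simp_all add: val_mult val_one)
  ultimately show ?thesis by (simp add: val_mult)
qed

text \<open>The perturbation argument, for the ball around 0. The values at the common point \<open>x\<close> serve to
  bound the constant term of \<open>Q' - Q\<close> from below.\<close>

lemma count_roots_in_ball_eq:
  assumes Q: "Q = smult e (\<Prod>d\<in>#D. [:-d, 1:])" "e \<noteq> 0"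
    and Q': "Q' = smult e' (\<Prod>d\<in>#D'. [:-d, 1:])" "e' \<noteq> 0"
    and R: "Q' - Q = smult f (\<Prod>d\<in>#R. [:-d, 1:])" "\<And>d. d \<in># R \<Longrightarrow> w d < Fin \<gamma>"
    and "poly Q 0 = 0" "poly Q' x = 0" "Fin \<gamma> \<le> w x"
  shows "size {#d \<in># D. Fin \<gamma> \<le> w d#} = size {#d \<in># D'. Fin \<gamma> \<le> w d#}"
proof (cases "f = 0")
  case True
  obtain m where m: "dominant_index \<gamma> Q (size {#d \<in># D. Fin \<gamma> \<le> w d#}) m"
    using dominant_index_of_split[OF Q(2)] Q(1) by blast
  obtain m' where m': "dominant_index \<gamma> Q' (size {#d \<in># D'. Fin \<gamma> \<le> w d#}) m'"
    using dominant_index_of_split[OF Q'(2)] Q'(1) by blast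
  from True R have "Q' = Q" by simp
  with m m' dominant_index_unique show ?thesis by metis
next
  case False
  define j where "j = size {#d \<in># D. Fin \<gamma> \<le> w d#}"
  obtain m where m: "dominant_index \<gamma> Q j m"
      and m_eq: "Fin m = w e + (\<Sum>d\<in>#D. min (Fin \<gamma>) (w d))"
    using dominant_index_of_split[OF Q(2), of \<gamma> D] Q(1) j_def by auto
  obtain m' where m': "dominant_index \<gamma> Q' (size {#d \<in># D'. Fin \<gamma> \<le> w d#}) m'"
    using dominant_index_of_split[OF Q'(2)] Q'(1) by blast
  have R0: "{#d \<in># R. Fin \<gamma> \<le> w d#} = {#}" by (intro multiset_eqI) (auto simp: count_eq_zero_iff dest: R(2))
  then obtain k where k: "dominant_index \<gamma> (Q' - Q) 0 k"
      and k_eq: "Fin k = w f + (\<Sum>d\<in>#R. min (Fin \<gamma>) (w d))"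
    using dominant_index_of_split[OF False, of \<gamma> R, unfolded R0 size_empty, folded R(1)] by blast
  \<comment> \<open>The value of \<open>Q\<close> at a point of the ball is at least its Gauss value \<open>m\<close>, while that of \<open>Q' - Q\<close>
    equals its Gauss value \<open>k\<close>; at \<open>x\<close> the two values coincide.\<close>
  have "min (Fin \<gamma>) (w d) \<le> w (x - d)" for d
    using val_diff[of x d] \<open>Fin \<gamma> \<le> w x\<close> by (meson min.mono order_refl order_trans)
  hence "(\<Sum>d\<in>#D. min (Fin \<gamma>) (w d)) \<le> (\<Sum>d\<in>#D. w (x - d))"
    by (induction D) (simp_all add: add_mono)
  hence "Fin m \<le> w (poly Q x)"
    unfolding m_eq Q(1) val_poly_split by (rule add_left_mono)
  also have "w (poly Q x) = w (poly (Q' - Q) x)"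
    using \<open>poly Q' x = 0\<close> by (simp add: val_uminus)
  also have "\<dots> = Fin k"
  proof -
    have "w (x - d) = min (Fin \<gamma>) (w d)" if "d \<in># R" for d
    proof -
      have "w d < w x" using R(2)[OF that] \<open>Fin \<gamma> \<le> w x\<close> by simp
      hence "w (x - d) = w d" using val_add_eq[of "-d" x] by (simp add: val_uminus)
      also have "\<dots> = min (Fin \<gamma>) (w d)" by (rule min.absorb4[symmetric], rule R(2)[OF that])
      finally show ?thesis .
    qed
    hence "image_mset (\<lambda>d. w (x - d)) R = image_mset (\<lambda>d. min (Fin \<gamma>) (w d)) R"
      by (rule image_mset_cong)
    thus ?thesis unfolding R(1) val_poly_split k_eq by (rule arg_cong)
  qed
  finally have mk: "Fin m \<le> Fin k" .
  have "j \<noteq> 0"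
  proof
    assume "j = 0"
    hence "gauss_term \<gamma> Q 0 = Fin m" using m by (simp add: dominant_index_def)
    thus False using \<open>poly Q 0 = 0\<close> by (simp add: gauss_term_def poly_0_coeff_0 val_zero zero_extended_def)
  qed
  have "dominant_index \<gamma> Q' j m"
    unfolding dominant_index_def
  proof (intro conjI allI impI)
    fix i
    have "Fin m \<le> gauss_term \<gamma> Q i" "Fin m \<le> gauss_term \<gamma> (Q' - Q) i"
      using m k order_trans[OF mk] unfolding dominant_index_def by blast+
    thus "Fin m \<le> gauss_term \<gamma> Q' i"
      using gauss_term_add[of \<gamma> Q i "Q' - Q"] by (simp add: min_def split: if_splits)
  next
    have "gauss_term \<gamma> Q j = Fin m" "Fin m < gauss_term \<gamma> (Q' - Q) j"
      using m k le_less_trans[OF mk] \<open>j \<noteq> 0\<close> unfolding dominant_index_def by blast+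
    thus "gauss_term \<gamma> Q' j = Fin m"
      using gauss_term_add_eq[of \<gamma> Q j "Q' - Q"] by simp
  next
    fix i assume "i > j"
    hence "Fin m < gauss_term \<gamma> Q i" "Fin m < gauss_term \<gamma> (Q' - Q) i"
      using m k le_less_trans[OF mk] unfolding dominant_index_def by (blast, metis neq0_conv not_less0)
    thus "Fin m < gauss_term \<gamma> Q' i"
      using gauss_term_add[of \<gamma> Q i "Q' - Q"] by (simp add: min_def split: if_splits)
  qed
  from dominant_index_unique[OF this m'] show ?thesis by (simp add: j_def)
qed

end


section \<open>Polynomials as lists of coefficients\<close>

lemma type_ring_simps [simp]:
  "carrier (ring_of_type_algebra :: 'l::field ring) = UNIV"
  "x \<otimes>\<^bsub>ring_of_type_algebra\<^esub> y = x * (y::'l::field)"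
  "x \<oplus>\<^bsub>ring_of_type_algebra\<^esub> y = x + (y::'l::field)"
  "\<one>\<^bsub>ring_of_type_algebra\<^esub> = (1::'l::field)"
  "\<zero>\<^bsub>ring_of_type_algebra\<^esub> = (0::'l::field)"
  by (simp_all add: ring_of_type_algebra_def)

lemma field_type_ring: "field (ring_of_type_algebra :: 'l::field ring)"
  by (rule field_from_type_algebra)

lemma type_ring_a_inv [simp]: "\<ominus>\<^bsub>ring_of_type_algebra\<^esub> x = - (x::'l::field)"
proof -
  interpret L: field "ring_of_type_algebra :: 'l ring" by (rule field_type_ring)
  show ?thesis using L.minus_equality[of "-x" x] by simp
qed

lemma type_ring_pow [simp]: "x [^]\<^bsub>ring_of_type_algebra\<^esub> (n::nat) = (x::'l::field) ^ n"
proof -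
  interpret L: field "ring_of_type_algebra :: 'l ring" by (rule field_type_ring)
  show ?thesis by (induction n) (auto simp: L.nat_pow_Suc mult.commute)
qed

lemma type_ring_finsum:
  fixes f :: "nat \<Rightarrow> 'l::field"
  shows "finsum ring_of_type_algebra f {..n::nat} = (\<Sum>i\<le>n. f i)"
proof -
  interpret L: field "ring_of_type_algebra :: 'l ring" by (rule field_type_ring)
  show ?thesis by (induction n) (auto simp: L.finsum_Suc)
qed

text \<open>Elements of \<open>univ_poly\<close> begin with the leading coefficient, arguments of \<open>Poly\<close> with the
  constant term.\<close>

definition poly_of_coeff_list :: "'l::field list \<Rightarrow> 'l poly" where
  "poly_of_coeff_list p = Poly (rev p)"

lemma poly_of_coeff_list_Nil [simp]: "poly_of_coeff_list [] = 0"
  by (simp add: poly_of_coeff_list_def)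

lemma poly_of_coeff_list_Cons [simp]:
   "poly_of_coeff_list (c # p) = poly_of_coeff_list p + Polynomial.monom c (length p)"
  by (simp add: poly_of_coeff_list_def Poly_append monom_altdef smult_monom)

lemma coeff_poly_of_coeff_list:
  fixes p :: "'l::field list"
  shows "Polynomial.coeff (poly_of_coeff_list p) = ring.coeff ring_of_type_algebra p"
proof -
  interpret L: field "ring_of_type_algebra :: 'l ring" by (rule field_type_ring)
  have beyond: "Polynomial.coeff (poly_of_coeff_list p) i = 0" if "i \<ge> length p" for p :: "'l list" and i
    using that by (induction p) auto
  show ?thesis
    by (induction p) (auto simp: fun_eq_iff beyond L.coeff_length)
qed

lemma poly_of_coeff_list_eval:
  fixes p :: "'l::field list"
  shows "poly (poly_of_coeff_list p) x = ring.eval ring_of_type_algebra p x"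
proof -
  interpret L: field "ring_of_type_algebra :: 'l ring" by (rule field_type_ring)
  show ?thesis by (induction p) (auto simp: poly_monom add_ac)
qed

lemma poly_of_coeff_list_mult:
  fixes p :: "'l::field list"
  shows "poly_of_coeff_list (p \<otimes>\<^bsub>univ_poly ring_of_type_algebra K\<^esub> q) = poly_of_coeff_list p * poly_of_coeff_list q"
proof -
  interpret L: field "ring_of_type_algebra :: 'l ring" by (rule field_type_ring)
  show ?thesis
    by (intro poly_eqI) (simp add: coeff_poly_of_coeff_list coeff_mult univ_poly_mult L.poly_mult_coeff type_ring_finsum)
qed

lemma coeffs_poly_of_coeff_list:
  assumes "p \<in> carrier (univ_poly ring_of_type_algebra K)"
  shows "coeffs (poly_of_coeff_list p) = rev p"
proof (cases "p = []")
  case False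
  with assms have "hd p \<noteq> 0" by (simp add: univ_poly_def polynomial_def)
  thus ?thesis using False 
    by (cases p) (simp_all add: poly_of_coeff_list_def strip_while_idem_iff no_trailing_unfold)
qed auto

lemma coeff_list_of_poly:
  assumes "set (coeffs P) \<subseteq> K"
  shows "rev (coeffs P) \<in> carrier (univ_poly ring_of_type_algebra K)"
    and "poly_of_coeff_list (rev (coeffs P)) = P"
  using assms
  by (auto simp: univ_poly_def polynomial_def poly_of_coeff_list_def hd_rev last_coeffs_eq_coeff_degree)

text \<open>Multiplicities in the root multiset are defined by divisibility by powers of linear factors.
  They become a factorization by splitting off one root at a time, which removes exactly
  one occurrence from the multiset.\<close>

lemma poly_of_coeff_list_splitted:
  fixes p :: "'l::field list"
  assumes "p \<in> carrier (poly_ring ring_of_type_algebra)" "p \<noteq> []"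
    and "ring.splitted ring_of_type_algebra p"
  shows "poly_of_coeff_list p = smult (hd p) (\<Prod>c\<in>#ring.roots ring_of_type_algebra p. [:-c, 1:])"
proof -
  interpret L: field "ring_of_type_algebra :: 'l ring" by (rule field_type_ring)
  show ?thesis using assms
  proof (induction "length p" arbitrary: p rule: less_induct)
    case less
    show ?case
    proof (cases "L.roots p = {#}")
      case True
      with less.prems have "length p = 1"
        by (cases p) (auto simp: L.splitted_def)
      then obtain c where "p = [c]" by (auto simp: length_Suc_conv)
      with True show ?thesis by (simp add: monom_0)
    next
      case False
      from L.not_empty_rootsE[OF less.prems(1) False] obtain c where
        c: "c \<in># L.roots p" "[1, -c] \<in> carrier (poly_ring ring_of_type_algebra)" "[1, -c] pdivides\<^bsub>ring_of_type_algebra\<^esub> p"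
        by auto
      then obtain q where q: "q \<in> carrier (poly_ring ring_of_type_algebra)" 
           "p = [1, -c] \<otimes>\<^bsub>poly_ring ring_of_type_algebra\<^esub> q"
        by (auto simp: pdivides_def factor_def)
      have "q \<noteq> []" using q less.prems(2) L.poly_mult_zero by (auto simp: univ_poly_mult)
      have roots: "L.roots p = add_mset c (L.roots q)"
        using L.poly_mult_degree_one_monic_imp_same_roots[of c q] q \<open>q \<noteq> []\<close> by simp
      have P: "poly_of_coeff_list p = [:-c, 1:] * poly_of_coeff_list q"
        unfolding q(2) poly_of_coeff_list_mult by (simp add: monom_altdef)
      have nz: "poly_of_coeff_list p \<noteq> 0" "poly_of_coeff_list q \<noteq> 0"
        using coeffs_poly_of_coeff_list[OF less.prems(1)] coeffs_poly_of_coeff_list[OF q(1)] less.prems(2) \<open>q \<noteq> []\<close>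
        by auto
      have len: "length p = Suc (length q)"
      proof -
        have "length (coeffs (poly_of_coeff_list p)) = Suc (length (coeffs (poly_of_coeff_list q)))"
          using nz unfolding P by (simp add: length_coeffs_degree degree_mult_eq del: mult_pCons_left)
        thus ?thesis using coeffs_poly_of_coeff_list[OF less.prems(1)] coeffs_poly_of_coeff_list[OF q(1)] by simp
      qed
      have hd: "hd p = hd q"
      proof -
        have "lead_coeff (poly_of_coeff_list p) = lead_coeff (poly_of_coeff_list q)"
          unfolding P lead_coeff_mult by simp
        thus ?thesis using coeffs_poly_of_coeff_list[OF less.prems(1)] coeffs_poly_of_coeff_list[OF q(1)] nz less.prems(2) \<open>q \<noteq> []\<close>
          by (simp add: last_coeffs_eq_coeff_degree[symmetric] last_rev)
      qed
      have "size (L.roots q) = length q - 1" 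
        using less.prems(3) roots len by (simp add: L.splitted_def) 
      hence "L.splitted q" by (simp add: L.splitted_def)
      from less.hyps[OF _ q(1) \<open>q \<noteq> []\<close> this] len have
        "poly_of_coeff_list q = smult (hd q) (\<Prod>c\<in>#L.roots q. [:-c, 1:])" by simp
      thus ?thesis unfolding P roots hd by simp
    qed
  qed
qed


section \<open>Minimal polynomials over a subfield\<close>

text \<open>As \<open>b\<close> is algebraic, the polynomial expressions in \<open>b\<close> already form a field, and the powers of
  \<open>b\<close> below the degree of its minimal polynomial are a basis of it.\<close>

lemma ext_degree_eq_Irr:
  fixes K :: "'l::field set"
  assumes "algebraic_closure (ring_of_type_algebra :: 'l ring) K"
  shows "ext_degree K b = length (ring.Irr ring_of_type_algebra K b) - 1"
proof -
  interpret L: algebraic_closure "ring_of_type_algebra :: 'l ring" K by (rule assms)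
  have sf: "subfield K ring_of_type_algebra" by (rule L.subfield_axioms)
  have alg: "\<not> L.transcendental K b"
    using L.algebraic_extension[of b] by (simp add: over_def)
  have "generate_field ring_of_type_algebra (insert b K) = L.simple_extension K b"
  proof (rule L.generate_fieldI[symmetric])
    show "subfield (L.simple_extension K b) ring_of_type_algebra"
      using L.simple_extension_is_subfield[OF sf] alg by (simp add: over_def)
    show "insert b K \<subseteq> L.simple_extension K b"
      using L.simple_extension_mem[OF subfieldE(1)[OF sf]] L.simple_extension_incl[of K b] by auto
    show "L.simple_extension K b \<subseteq> E" if "subfield E ring_of_type_algebra" "insert b K \<subseteq> E" for E
      using L.simple_extension_subring_incl[OF subfieldE(1)[OF that(1)]] that(2) by simp
  qed simp
  thus ?thesis
    using L.simple_extension_dim[OF sf, of b] alg by (simp add: ext_degree_def over_def)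
qed

lemma min_poly_properties:
  fixes K :: "'l::field set" and b :: 'l
  assumes "algebraic_closure (ring_of_type_algebra :: 'l ring) K"
  defines "P \<equiv> poly_of_coeff_list (ring.Irr ring_of_type_algebra K b)"
  shows "set (coeffs P) \<subseteq> K" "poly P b = 0" "lead_coeff P = 1" "degree P = ext_degree K b"
    "P = (\<Prod>c\<in>#ring.roots ring_of_type_algebra (ring.Irr ring_of_type_algebra K b). [:-c, 1:])"
proof -
  interpret L: algebraic_closure "ring_of_type_algebra :: 'l ring" K by (rule assms)
  define p where "p = L.Irr K b"
  have sf: "subfield K ring_of_type_algebra" by (rule L.subfield_axioms)
  have alg: "L.algebraic K b"
    using L.algebraic_extension[of b] by (simp add: over_def)
  have p: "p \<in> carrier (univ_poly ring_of_type_algebra K)" "hd p = 1" "L.eval p b = 0"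
    using L.IrrE[OF sf, of b] alg by (auto simp: over_def p_def)
  have p': "p \<in> carrier (poly_ring ring_of_type_algebra)"
    using p(1) by (auto simp: univ_poly_def polynomial_def)
  have "p \<noteq> []"
    using L.IrrE(2)[OF sf, of b] L.pirreducible_degree[OF sf p(1)] alg by (auto simp: p_def over_def)
  have co: "coeffs P = rev p" using coeffs_poly_of_coeff_list[OF p(1)] by (simp add: P_def p_def)
  show "set (coeffs P) \<subseteq> K" unfolding co using p(1) by (auto simp: univ_poly_def polynomial_def)
  show "poly P b = 0" using p(3) by (simp add: P_def p_def poly_of_coeff_list_eval)
  have "P \<noteq> 0" using co \<open>p \<noteq> []\<close> by auto
  thus "lead_coeff P = 1"
    using co p(2) \<open>p \<noteq> []\<close> by (simp add: last_coeffs_eq_coeff_degree[symmetric] last_rev)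
  show "degree P = ext_degree K b"
    using co by (simp add: degree_eq_length_coeffs ext_degree_eq_Irr[OF assms(1)] p_def)
  show "P = (\<Prod>c\<in>#L.roots (L.Irr K b). [:-c, 1:])"
    using poly_of_coeff_list_splitted[OF p' \<open>p \<noteq> []\<close> L.roots_over_subfield[OF p(1)]] p(2)
    by (simp add: P_def p_def)
qed

lemma poly_over_subfield_splits:
  fixes K :: "'l::field set" and r :: "'l poly"
  assumes "algebraic_closure (ring_of_type_algebra :: 'l ring) K" "set (coeffs r) \<subseteq> K"
  shows "\<exists>R. r = smult (lead_coeff r) (\<Prod>c\<in>#R. [:-c, 1:])"
proof (cases "r = 0")
  case False
  interpret L: algebraic_closure "ring_of_type_algebra :: 'l ring" K by (rule assms)
  define p where "p = rev (coeffs r)"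
  have p: "p \<in> carrier (univ_poly ring_of_type_algebra K)" "poly_of_coeff_list p = r"
    using coeff_list_of_poly[OF assms(2)] by (auto simp: p_def)
  have p': "p \<in> carrier (poly_ring ring_of_type_algebra)"
    using p(1) by (auto simp: univ_poly_def polynomial_def)
  have "p \<noteq> []" "hd p = lead_coeff r" 
    using False by (auto simp: p_def hd_rev last_coeffs_eq_coeff_degree)
  with poly_of_coeff_list_splitted[OF p' this(1) L.roots_over_subfield[OF p(1)]] p(2) show ?thesis 
    by auto
qed simp

lemma ext_degree_le_degree:
  fixes K :: "'l::field set" and r :: "'l poly"
  assumes "algebraic_closure (ring_of_type_algebra :: 'l ring) K" "set (coeffs r) \<subseteq> K"
    and "r \<noteq> 0" "poly r b = 0"
  shows "ext_degree K b \<le> degree r"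
proof -
  interpret L: algebraic_closure "ring_of_type_algebra :: 'l ring" K by (rule assms)
  have sf: "subfield K ring_of_type_algebra" by (rule L.subfield_axioms)
  have alg: "L.algebraic K b"
    using L.algebraic_extension[of b] by (simp add: over_def)
  define p where "p = rev (coeffs r)"
  have p: "p \<in> carrier (univ_poly ring_of_type_algebra K)" "poly_of_coeff_list p = r"
    using coeff_list_of_poly[OF assms(2)] by (auto simp: p_def)
  have "p \<noteq> []" using assms(3) by (auto simp: p_def)
  have "L.eval p b = 0" using assms(4) p(2) by (simp flip: poly_of_coeff_list_eval)
  hence "L.Irr K b pdivides\<^bsub>ring_of_type_algebra\<^esub> p"
    using L.Irr_minimal[OF sf, of b p] alg p(1) by (simp add: over_def)
  hence "length (L.Irr K b) - 1 \<le> length p - 1"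
    using L.pdivides_imp_degree_le[OF subfieldE(1)[OF sf] _ p(1) \<open>p \<noteq> []\<close>] L.IrrE(1)[OF sf, of b] alg
    by (simp add: over_def)
  thus ?thesis by (simp add: ext_degree_eq_Irr[OF assms(1)] p_def degree_eq_length_coeffs)
qed

lemma subfield_coeffs_diff:
  fixes p q :: "'l::field poly"
  assumes K: "subfield K (ring_of_type_algebra :: 'l ring)"
    and "set (coeffs p) \<subseteq> K" "set (coeffs q) \<subseteq> K"
  shows "set (coeffs (p - q)) \<subseteq> K"
proof
  have sr: "subring K (ring_of_type_algebra :: 'l ring)" using subfieldE(1)[OF K] .
  have co: "Polynomial.coeff p i \<in> K" if "set (coeffs p) \<subseteq> K" for p i
    using that coeff_in_coeffs[of p i] subringE(2)[OF sr]
    by (cases "p = 0 \<or> i > degree p") (auto simp: coeff_eq_0)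
  fix x assume "x \<in> set (coeffs (p - q))"
  then obtain i where "x = Polynomial.coeff p i + - Polynomial.coeff q i"
    by (auto simp: coeffs_def split: if_splits)
  thus "x \<in> K" 
    using subringE(7)[OF sr co[OF assms(2), of i] subringE(5)[OF sr co[OF assms(3), of i]]] by simp
qed


section \<open>Minimal pairs of definition\<close>

lemma krull_valuation_const:
  assumes "krull_valuation v"
  shows "krull_valuation (\<lambda>c. v (const_rf c))"
proof -
  have "const_rf (x * y) = const_rf x * const_rf y" 
       "const_rf (x + y) = const_rf x + const_rf y" for x y :: 'a
    by (simp_all flip: to_fract_add to_fract_mult)
  thus ?thesis using assms unfolding krull_valuation_def by simp
qed

lemma pcompose_split:
  "pcompose (smult e (\<Prod>c\<in>#C. [:-c, 1:])) [:a, 1:] = smult e (\<Prod>d\<in>#image_mset (\<lambda>c. c - a) C. [:-d, 1:])"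
  for e :: "'a::field"
proof -
  have "pcompose (\<Prod>c\<in>#C. [:-c, 1:]) [:a, 1:] = (\<Prod>d\<in>#image_mset (\<lambda>c. c - a) C. [:-d, 1:])"
  proof (induction C)
    case (add c C)
    have "pcompose [:-c, 1:] [:a, 1:] = [:-(c-a), 1:]" by (simp add: pcompose_pCons)
    with add show ?case by (simp only: pcompose_mult image_mset_add_mset prod_mset.add_mset)
  qed (simp add: pcompose_1)
  thus ?thesis by (simp add: pcompose_smult)
qed

theorem theorem1p2:
  fixes K :: "'l::field set"
    and v :: "'l poly fract \<Rightarrow> 'g::linordered_ab_group_add extended"
    and a a' :: 'l
    and \<gamma> :: 'g
  assumes "algebraic_closure (ring_of_type_algebra :: 'l ring) K"
    and "krull_valuation v"
    and "valuation_transcendental v (rational_functions K) (const_rf ` K)"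
    and "minimal_pair v K a \<gamma>"
    and "minimal_pair v K a' \<gamma>"
  shows "j_invariant v K \<gamma> a = j_invariant v K \<gamma> a'"
proof -
  interpret L: algebraic_closure "ring_of_type_algebra :: 'l ring" K by (rule assms)
  define w where "w = (\<lambda>c. v (const_rf c))"
  have w: "krull_valuation w" unfolding w_def by (rule krull_valuation_const[OF assms(2)])
  have near: "Fin \<gamma> \<le> w (a - a')"
  proof -
    have "const_rf (a - a') = (X_rf - const_rf a') - (X_rf - const_rf a)"
      by (simp flip: to_fract_diff)
    thus ?thesis
      using val_diff[OF assms(2), of "X_rf - const_rf a'" "X_rf - const_rf a"] assms(4,5) 
      by (simp add: w_def minimal_pair_def)
  qed
  have same_ball: "Fin \<gamma> \<le> w (a - c) \<longleftrightarrow> Fin \<gamma> \<le> w (a' - c)" for c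
    using val_add[OF w, of "a - a'" "a' - c"] val_diff[OF w, of "a - c" "a - a'"] near
    by (simp add: min_def split: if_splits; meson order_trans)
  have min_deg: "ext_degree K a \<le> ext_degree K b" if "Fin \<gamma> \<le> w (a - b)" for b
    using assms(4) that by (simp add: minimal_pair_def w_def)
  have deg: "ext_degree K a = ext_degree K a'"
    using assms(4,5) near val_minus_commute[OF w, of a a'] 
    by (intro order_antisym) (simp_all add: minimal_pair_def w_def)
  define C where "C = L.roots (L.Irr K a)"
  define C' where "C' = L.roots (L.Irr K a')"
  define P where "P = poly_of_coeff_list (L.Irr K a)"
  define P' where "P' = poly_of_coeff_list (L.Irr K a')"
  note P = min_poly_properties[OF assms(1), of a, folded P_def C_def]
  note P' = min_poly_properties[OF assms(1), of a', folded P'_def C'_def]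
  have coeffs_diff: "set (coeffs (P' - P)) \<subseteq> K"
    by (intro subfield_coeffs_diff[OF L.subfield_axioms] P(1) P'(1))
  \<comment> \<open>If \<open>P' = P\<close>, the leading coefficient here is 0, and the empty multiset serves as \<open>R\<close>.\<close>
  obtain R where R: "P' - P = smult (lead_coeff (P' - P)) (\<Prod>c\<in>#R. [:-c, 1:])"
    and far: "\<And>c. c \<in># R \<Longrightarrow> w (c - a) < Fin \<gamma>"
  proof (cases "P' = P")
    case True
    show ?thesis by (rule that[of "{#}"]) (simp_all add: True)
  next
    case False
    obtain R where R: "P' - P = smult (lead_coeff (P' - P)) (\<Prod>c\<in>#R. [:-c, 1:])"
      using poly_over_subfield_splits[OF assms(1) coeffs_diff] by blast
    have "w (c - a) < Fin \<gamma>" if "c \<in># R" for c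
    proof (rule ccontr)
      assume "\<not> ?thesis"
      \<comment> \<open>A root in the ball would have degree at least that of \<open>P\<close>, while \<open>P' - P\<close> has smaller degree.\<close>
      hence "ext_degree K a \<le> ext_degree K c"
        using min_deg[of c] val_minus_commute[OF w, of a c] by simp
      also have "poly (\<Prod>c\<in>#R. [:-c, 1:]) c = 0"
        using that by (induction R) auto
      hence "poly (P' - P) c = 0" by (subst R) simp
      hence "ext_degree K c \<le> degree (P' - P)"
        using ext_degree_le_degree[OF assms(1) coeffs_diff] False by simp
      also have "\<dots> < degree P"
      proof (rule degree_lessI)
        show "\<forall>k\<ge>degree P. Polynomial.coeff (P' - P) k = 0"
        proof (intro allI impI)
          fix k assume "k \<ge> degree P"
          thus "Polynomial.coeff (P' - P) k = 0"
            using P(3,4) P'(3,4) deg 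
            by (cases "k = degree P") (auto simp: coeff_eq_0)
        qed
      qed (use False in auto)
      finally show False by (simp add: P(4))
    qed
    with R that show ?thesis by blast
  qed
  define Q where "Q = pcompose P [:a, 1:]"
  define Q' where "Q' = pcompose P' [:a, 1:]"
  have Q_diff: "Q' - Q = smult (lead_coeff (P' - P)) (\<Prod>d\<in>#image_mset (\<lambda>c. c - a) R. [:-d, 1:])"
    unfolding Q_def Q'_def pcompose_diff[symmetric] by (subst R) (rule pcompose_split)
  have "size {#d \<in># image_mset (\<lambda>c. c - a) C. Fin \<gamma> \<le> w d#} = size {#d \<in># image_mset (\<lambda>c. c - a) C'. Fin \<gamma> \<le> w d#}"
  proof (rule count_roots_in_ball_eq[OF w _ _ _ _ Q_diff])
    show "Q = smult 1 (\<Prod>d\<in>#image_mset (\<lambda>c. c - a) C. [:- d, 1:])"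
      using pcompose_split[of 1 C a] P(5) by (simp add: Q_def)
    show "Q' = smult 1 (\<Prod>d\<in>#image_mset (\<lambda>c. c - a) C'. [:- d, 1:])"
      using pcompose_split[of 1 C' a] P'(5) by (simp add: Q'_def)
    show "poly Q 0 = 0" using P(2) by (simp add: Q_def poly_pcompose)
    show "poly Q' (a' - a) = 0" using P'(2) by (simp add: Q'_def poly_pcompose)
    show "Fin \<gamma> \<le> w (a' - a)" using near val_minus_commute[OF w, of a a'] by simp
  qed (auto intro: far)
  hence "size {#c \<in># C. Fin \<gamma> \<le> w (a - c)#} = size {#c \<in># C'. Fin \<gamma> \<le> w (a - c)#}"
    by (simp add: filter_mset_image_mset val_minus_commute[OF w, of a])
  thus ?thesis
    using same_ball by (simp add: j_invariant_def C_def C'_def w_def)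
qed

end
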